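(* Let $(M_{n,k})$ be defined for natural numbers $n\ge k\ge1$ by: $M_{n,1}=n$; $M_{k,k}=k$; and for $n\ge k>1$, $$M_{n+1,k}=R^{\,{\mathcal{R}_1(M_{n,k},\,k-1)\brack k-1}}(n+1,k).$$ Then for all natural numbers $n\ge k$, $\mathcal{R}_1(n,k)\le M_{2n-1,k}$.
   Context: $T_n=n(n+1)/2$, $T_0=0$. A finite set $X\subseteq\mathbb{N}$ with $|X|=T_n$, enumerated $x_1<\dots<x_{T_n}$, has $i$-th level $\{x_{T_{i-1}+1},\dots,x_{T_i}\}$ for $1\le i\le n$; $\triangle_n$ is the set of all such sets. For such sets, $X\le Y$ means $X\subseteq Y$ and every level of $X$ is contained in a single level of $Y$, distinct levels of $X$ being contained in distinct levels of $Y$; $\triangle_k(B)=\{Z\in\triangle_k:Z\le B\}$. For natural numbers $k\le p,q$, a completed game of Mines$_m(p,q,k)$ is a partition $\triangle_k(B)=X\sqcup Y$ with $B\in\triangle_m$; it is a win for player one if there is $Z\in\triangle_p(B)$ with $\triangle_k(Z)\subseteq X$, a win for player two if there is $Z\in\triangle_q(B)$ with $\triangle_k(Z)\subseteq Y$, and a draw otherwise. $\mathcal{R}_1(p,q,k)$ is the least $m\ge\max(p,q)$ such that no completed game of Mines$_m(p,q,k)$ is a draw, and $\mathcal{R}_1(n,k)=\mathcal{R}_1(n,n,k)$. The numbers ${n\brack k}$ are defined by ${n\brack0}={n\brack n}=1$ and ${n\brack k}={n-1\brack k}+\binom nk{n-1\brack k-1}$ for $0<k<n$. $R(n,k)$ is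 the least $N$ such that every 2-coloring of the $k$-element subsets of an $N$-element set admits an $n$-element subset all of whose $k$-element subsets have the same color; $R^1(n,k)=R(n,k)$ and $R^{l+1}(n,k)=R(R^{l}(n,k),k)$. *)

theory Defs
  imports Complex_Main "HOL-Library.Ramsey" "HOL-Library.Nat_Bijection"
begin

(* T_n is the library's triangle n; list positions are 0-based, so x_{j+1} is at position j. *)
definition level :: "nat set \<Rightarrow> nat \<Rightarrow> nat set" where
  "level X i = {sorted_list_of_set X ! j | j. triangle (i - 1) \<le> j \<and> j < triangle i}"

definition triangles :: "nat \<Rightarrow> nat set set" where
  "triangles n = {X. finite X \<and> card X = triangle n}"

(* For X in triangles n, the condition triangle i \<le> card X is i \<le> n. *)
definition levels :: "nat set \<Rightarrow> nat set set" where
  "levels X = {level X i | i. 1 \<le> i \<and> triangle i \<le> card X}"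

definition triangle_le :: "nat set \<Rightarrow> nat set \<Rightarrow> bool"  (infix \<open>\<sqsubseteq>\<^sub>t\<close> 50) where
  "X \<sqsubseteq>\<^sub>t Y \<longleftrightarrow> X \<subseteq> Y \<and>
     (\<exists>f. inj_on f (levels X) \<and> (\<forall>L \<in> levels X. f L \<in> levels Y \<and> L \<subseteq> f L))"

definition triangles_below :: "nat \<Rightarrow> nat set \<Rightarrow> nat set set" where
  "triangles_below k B = {Z \<in> triangles k. Z \<sqsubseteq>\<^sub>t B}"

definition completed_game :: "nat \<Rightarrow> nat \<Rightarrow> nat set \<Rightarrow> nat set set \<Rightarrow> nat set set \<Rightarrow> bool" where
  "completed_game m k B X Y \<longleftrightarrow>
     B \<in> triangles m \<and> X \<union> Y = triangles_below k B \<and> X \<inter> Y = {}"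

(* Player one wins with n = p and C = X, player two with n = q and C = Y. *)
definition wins :: "nat \<Rightarrow> nat \<Rightarrow> nat set \<Rightarrow> nat set set \<Rightarrow> bool" where
  "wins n k B C \<longleftrightarrow> (\<exists>Z \<in> triangles_below n B. triangles_below k Z \<subseteq> C)"

definition game_draw :: "nat \<Rightarrow> nat \<Rightarrow> nat \<Rightarrow> nat set \<Rightarrow> nat set set \<Rightarrow> nat set set \<Rightarrow> bool" where
  "game_draw p q k B X Y \<longleftrightarrow> \<not> wins p k B X \<and> \<not> wins q k B Y"

definition mines_number :: "nat \<Rightarrow> nat \<Rightarrow> nat \<Rightarrow> nat" where
  "mines_number p q k = (LEAST m. max p q \<le> m \<and>
     (\<forall>B X Y. completed_game m k B X Y \<longrightarrow> \<not> game_draw p q k B X Y))"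

abbreviation diag_mines_number :: "nat \<Rightarrow> nat \<Rightarrow> nat" where
  "diag_mines_number n k \<equiv> mines_number n n k"

(* Only the values with k \<le> n are meaningful. *)
fun bracket :: "nat \<Rightarrow> nat \<Rightarrow> nat" where
  "bracket n k =
     (if k = 0 \<or> k = n then 1
      else if k < n then bracket (n - 1) k + (n choose k) * bracket (n - 1) (k - 1)
      else 0)"

declare bracket.simps [simp del]

lemma bracket_0: "bracket n 0 = 1"
  and bracket_diag: "bracket n n = 1"
  and bracket_rec: "0 < k \<Longrightarrow> k < n \<Longrightarrow>
    bracket n k = bracket (n - 1) k + (n choose k) * bracket (n - 1) (k - 1)"
  by (subst bracket.simps, simp)+

definition ramsey_number :: "nat \<Rightarrow> nat \<Rightarrow> nat" where
  "ramsey_number n k = (LEAST N. partn_lst {..<N} [n, n] k)"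

definition ramsey_iter :: "nat \<Rightarrow> nat \<Rightarrow> nat \<Rightarrow> nat" where
  "ramsey_iter l n k = ((\<lambda>x. ramsey_number x k) ^^ l) n"

lemma ramsey_iter_1: "ramsey_iter 1 n k = ramsey_number n k"
  and ramsey_iter_Suc: "ramsey_iter (Suc l) n k = ramsey_number (ramsey_iter l n k) k"
  by (simp_all add: ramsey_iter_def)

(* Only the values with 1 \<le> k \<le> n are meaningful; they are characterised by the
   three equations proved below. *)
fun mines_bound :: "nat \<Rightarrow> nat \<Rightarrow> nat" where
  "mines_bound n k =
     (if k \<le> 1 then n
      else if n \<le> k then k
      else ramsey_iter (bracket (diag_mines_number (mines_bound (n - 1) k) (k - 1)) (k - 1)) n k)"

declare mines_bound.simps [simp del]

lemma mines_bound_1: "mines_bound n 1 = n"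
  and mines_bound_diag: "mines_bound k k = k"
  and mines_bound_Suc: "1 < k \<Longrightarrow> k \<le> n \<Longrightarrow>
    mines_bound (Suc n) k =
      ramsey_iter (bracket (diag_mines_number (mines_bound n k) (k - 1)) (k - 1)) (Suc n) k"
  by (subst mines_bound.simps, simp)+

end

theory Submission
  imports Defs
begin

text \<open>
  By induction on \<open>n\<close>, every 2-colouring of the \<open>k\<close>-triangles below a triangle with
  \<open>M\<^sub>n\<^sub>,\<^sub>k\<close> levels admits, for each colour, a monochromatic triangle, such that the numbers of
  levels of the two triangles add up to at least \<open>n + k - 1\<close>. In the step one chooses a triangle
  \<open>B'\<close> with \<open>N = \<R>\<^sub>1(M\<^sub>n\<^sub>,\<^sub>k, k-1)\<close> levels below all but the last level, and applies
  Ramsey's theorem inside the last level once for each of the at most \<open>bracket N (k - 1)\<close> many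
  \<open>(k-1)\<close>-triangles below \<open>B'\<close>. This shrinks the last level to \<open>n + 1\<close> points such that the
  colour of a \<open>k\<close>-triangle ending there depends only on its first \<open>k - 1\<close> levels. The game for
  \<open>k - 1\<close> on \<open>B'\<close> then makes this colour constant, and the monochromatic triangle of that colour
  obtained from the induction hypothesis gains a level. With \<open>2n - 1\<close> in place of \<open>n\<close>, one of the
  two triangles has at least \<open>n\<close> levels.
\<close>

section \<open>Triangles and their levels\<close>

lemma triangle_le_iff [simp]: "triangle i \<le> triangle n \<longleftrightarrow> i \<le> n"
proof -
  have "strict_mono triangle"
    by (simp add: strict_mono_Suc_iff)
  then show ?thesis
    by (rule strict_mono_less_eq)
qed

lemma levels_eq_image: "X \<in> triangles n \<Longrightarrow> levels X = level X ` {1..n}"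
  unfolding levels_def triangles_def by auto

lemma sorted_list_of_set_Un:
  fixes A B :: "'a::linorder set"
  assumes "finite A" "finite B" "\<And>x y. x \<in> A \<Longrightarrow> y \<in> B \<Longrightarrow> x < y"
  shows "sorted_list_of_set (A \<union> B) = sorted_list_of_set A @ sorted_list_of_set B"
  using assms
  by (intro sorted_distinct_set_unique) (force simp: sorted_append)+

text \<open>Splits a triangle with \<open>n + 1\<close> levels into its first \<open>n\<close>
  levels \<open>A\<close> and its last level \<open>L\<close>. Peeling off last levels in this way
  drives the inductions on the number of levels.\<close>

locale top_level =
  fixes n :: nat and A L :: "nat set"
  assumes A: "A \<in> triangles n"
    and fin: "finite L" and card_L: "card L = Suc n"
    and less: "\<And>x y. x \<in> A \<Longrightarrow> y \<in> L \<Longrightarrow> x < y"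
begin

lemma disjoint: "A \<inter> L = {}"
  using less by fastforce

lemma L_nonempty: "L \<noteq> {}"
  using card_L by auto

lemma Un_in_triangles: "A \<union> L \<in> triangles (Suc n)"
  using A fin disjoint card_L by (auto simp: triangles_def card_Un_disjoint)

lemma sorted_list_Un: "sorted_list_of_set (A \<union> L) = sorted_list_of_set A @ sorted_list_of_set L"
  using A fin less by (intro sorted_list_of_set_Un) (auto simp: triangles_def)

lemma level_Un_lower:
  assumes "i \<le> n"
  shows "level (A \<union> L) i = level A i"
proof -
  have "triangle i \<le> length (sorted_list_of_set A)"
    using A assms by (auto simp: triangles_def)
  then show ?thesis
    unfolding level_def sorted_list_Un by (fastforce simp: nth_append)
qed

lemma level_Un_top: "level (A \<union> L) (Suc n) = L"
proof -
  have len: "length (sorted_list_of_set A) = triangle n"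
    using A by (auto simp: triangles_def)
  \<comment> \<open>Positions in the list of \<open>L\<close> are shifted by
    \<open>triangle n\<close>, the length of the list of \<open>A\<close>.\<close>
  have "level (A \<union> L) (Suc n)
      = {sorted_list_of_set L ! i | i. i < length (sorted_list_of_set L)}" (is "?l = ?r")
  proof
    show "?l \<subseteq> ?r"
    proof
      fix x assume "x \<in> ?l"
      then obtain j where "x = (sorted_list_of_set A @ sorted_list_of_set L) ! j"
        "triangle n \<le> j" "j < triangle (Suc n)"
        unfolding level_def sorted_list_Un by auto
      then show "x \<in> ?r"
        using card_L len by (auto simp: nth_append intro!: exI[of _ "j - triangle n"])
    qed
    show "?r \<subseteq> ?l"
    proof
      fix x assume "x \<in> ?r"
      then obtain i where "x = sorted_list_of_set L ! i" "i < Suc n"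
        using card_L by auto
      then show "x \<in> ?l"
        unfolding level_def sorted_list_Un using len
        by (auto simp: nth_append intro!: exI[of _ "triangle n + i"])
    qed
  qed
  also have "\<dots> = L"
    using fin by (simp only: set_conv_nth[symmetric] set_sorted_list_of_set)
  finally show ?thesis .
qed

lemma levels_Un: "levels (A \<union> L) = insert L (levels A)"
proof -
  have "{1..Suc n} = insert (Suc n) {1..n}"
    by auto
  then show ?thesis
    using level_Un_lower level_Un_top
    by (auto simp: levels_eq_image[OF A] levels_eq_image[OF Un_in_triangles] image_iff)
qed

end

lemma triangles_0 [simp]: "triangles 0 = {{}}"
  by (auto simp: triangles_def)

lemma triangles_SucE:
  assumes "X \<in> triangles (Suc n)"
  obtains A L where "top_level n A L" "X = A \<union> L"
proof
  let ?xs = "sorted_list_of_set X"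
  let ?A = "set (take (triangle n) ?xs)" and ?L = "set (drop (triangle n) ?xs)"
  have fin: "finite X" and len: "length ?xs = triangle n + Suc n"
    using assms by (auto simp: triangles_def)
  show X: "X = ?A \<union> ?L"
    using fin by (metis append_take_drop_id set_append set_sorted_list_of_set)
  have app: "sorted_wrt (<) (take (triangle n) ?xs @ drop (triangle n) ?xs)"
    by simp
  show "top_level n ?A ?L"
  proof
    show "?A \<in> triangles n" "card ?L = Suc n"
      using len by (auto simp: triangles_def distinct_card)
    show "x < y" if "x \<in> ?A" "y \<in> ?L" for x y
      using app that by (auto simp only: sorted_wrt_append)
  qed auto
qed

lemma triangles_induct [consumes 1, case_names 0 Suc]:
  assumes "X \<in> triangles n"
    and "P 0 {}"
    and "\<And>n A L. top_level n A L \<Longrightarrow> P n A \<Longrightarrow> P (Suc n) (A \<union> L)"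
  shows "P n X"
  using assms(1)
proof (induction n arbitrary: X)
  case 0
  then show ?case
    using assms(2) by simp
next
  case (Suc n)
  then show ?case
    using assms(3) by (metis top_level.A triangles_SucE)
qed

lemma levels_empty [simp]: "levels {} = {}"
  using levels_eq_image[of "{}" 0] by simp

lemma Union_levels: "X \<in> triangles n \<Longrightarrow> \<Union> (levels X) = X"
  by (induction rule: triangles_induct) (auto simp: top_level.levels_Un)

text \<open>Needed to see that a level contained in \<open>A\<close> cannot be contained in
  \<open>L\<close> as well.\<close>

lemma empty_notin_levels: "X \<in> triangles n \<Longrightarrow> {} \<notin> levels X"
  by (induction rule: triangles_induct) (auto simp: top_level.levels_Un dest: top_level.L_nonempty)

section \<open>The triangles below a triangle\<close>

lemma triangle_le_refl [simp]: "X \<sqsubseteq>\<^sub>t X"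
  by (auto simp: triangle_le_def intro!: exI[of _ id])

lemma triangle_le_trans:
  assumes "X \<sqsubseteq>\<^sub>t Y" "Y \<sqsubseteq>\<^sub>t Z"
  shows "X \<sqsubseteq>\<^sub>t Z"
proof -
  obtain f where f: "inj_on f (levels X)" "\<And>L. L \<in> levels X \<Longrightarrow> f L \<in> levels Y \<and> L \<subseteq> f L"
    using assms(1) by (auto simp: triangle_le_def)
  obtain g where g: "inj_on g (levels Y)" "\<And>L. L \<in> levels Y \<Longrightarrow> g L \<in> levels Z \<and> L \<subseteq> g L"
    using assms(2) by (auto simp: triangle_le_def)
  have "inj_on (g \<circ> f) (levels X)"
    using f g by (meson comp_inj_on image_subsetI inj_on_subset)
  moreover have "\<forall>L \<in> levels X. (g \<circ> f) L \<in> levels Z \<and> L \<subseteq> (g \<circ> f) L"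
    using f g by fastforce
  ultimately show ?thesis
    using assms unfolding triangle_le_def by blast
qed

lemma triangles_belowD: "X \<in> triangles_below k Y \<Longrightarrow> X \<in> triangles k"
  by (simp add: triangles_below_def)

lemma triangles_below_subset: "X \<in> triangles_below k Y \<Longrightarrow> X \<subseteq> Y"
  by (simp add: triangles_below_def triangle_le_def)

lemma triangles_below_self [simp]: "X \<in> triangles_below k X \<longleftrightarrow> X \<in> triangles k"
  by (simp add: triangles_below_def)

lemma triangles_below_trans:
  "X \<in> triangles_below k Y \<Longrightarrow> Y \<in> triangles_below m Z \<Longrightarrow> X \<in> triangles_below k Z"
  by (auto simp: triangles_below_def intro: triangle_le_trans)

lemma triangles_below_0 [simp]: "triangles_below 0 Y = {{}}"
  by (auto simp: triangles_below_def triangle_le_def)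

lemma triangles_below_index_le:
  assumes "X \<in> triangles_below k Y" "Y \<in> triangles n"
  shows "k \<le> n"
proof -
  have "card X \<le> card Y"
    using assms(2) triangles_below_subset[OF assms(1)]
    by (intro card_mono) (auto simp: triangles_def)
  then show ?thesis
    using assms triangles_belowD by (auto simp: triangles_def)
qed

lemma triangles_below_eq_empty: "Y \<in> triangles n \<Longrightarrow> n < k \<Longrightarrow> triangles_below k Y = {}"
  using triangles_below_index_le leD by blast

lemma triangles_below_diag:
  assumes "Y \<in> triangles n"
  shows "triangles_below n Y = {Y}"
proof -
  have "X = Y" if "X \<in> triangles_below n Y" for X
    using that assms triangles_below_subset[OF that] triangles_belowD[OF that]
    by (intro card_subset_eq) (auto simp: triangles_def)
  then show ?thesis
    using assms by auto
qed

lemma finite_triangles_below: "Y \<in> triangles n \<Longrightarrow> finite (triangles_below k Y)"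
  by (rule finite_subset[of _ "Pow Y"]) (auto simp: triangles_def dest: triangles_below_subset)

lemma (in top_level) top_level_subset:
  assumes V: "V \<in> triangles_below k A" and K: "K \<subseteq> L" "card K = Suc k"
  shows "top_level k V K"
  using assms fin less triangles_below_subset[OF V] triangles_belowD[OF V]
  by unfold_locales (auto intro: finite_subset)

text \<open>If the last level \<open>K\<close> of \<open>W\<close> goes into \<open>L\<close>,
  injectivity keeps the earlier levels out of \<open>L\<close>; otherwise all of \<open>W\<close>
  lies below \<open>A\<close>. Both the counting and the extension of monochromatic triangles rest
  on this recursion.\<close>

lemma (in top_level) triangles_below_Un:
  "triangles_below (Suc k) (A \<union> L) =
     triangles_below (Suc k) A
     \<union> {V \<union> K | V K. V \<in> triangles_below k A \<and> K \<subseteq> L \<and> card K = Suc k}"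
    (is "?lhs = ?low \<union> ?top")
proof (intro equalityI subsetI)
  fix W assume W: "W \<in> ?lhs"
  obtain V K where "top_level k V K" and W_eq: "W = V \<union> K"
    using W triangles_belowD triangles_SucE by metis
  interpret W: top_level k V K by fact
  obtain f where inj: "inj_on f (levels W)"
    and f: "\<And>M. M \<in> levels W \<Longrightarrow> f M \<in> insert L (levels A) \<and> M \<subseteq> f M"
    using W unfolding triangles_below_def triangle_le_def levels_Un by auto
  have lev_W: "levels W = insert K (levels V)"
    by (simp add: W_eq W.levels_Un)
  have Un_V: "\<Union> (levels V) = V" and Un_A: "\<Union> (levels A) = A"
    using Union_levels W.A A by auto
  have "K \<notin> levels V"
    using W.disjoint W.L_nonempty Un_V by blast
  show "W \<in> ?low \<union> ?top"
  proof (cases "f K = L")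
    case True
    have *: "f M \<in> levels A \<and> M \<subseteq> f M" if "M \<in> levels V" for M
    proof -
      have "f M \<noteq> f K"
        using inj that lev_W \<open>K \<notin> levels V\<close> by (auto simp: inj_on_def)
      then show ?thesis
        using f[of M] that True lev_W by auto
    qed
    have "V \<subseteq> A"
      using * Un_V Un_A by blast
    then have "V \<in> triangles_below k A"
      using * inj W.A lev_W
      by (auto simp: triangles_below_def triangle_le_def intro!: exI[of _ f])
    moreover have "K \<subseteq> L"
      using f[of K] True lev_W by auto
    ultimately show ?thesis
      using W_eq W.card_L by blast
  next
    case False
    then have "K \<subseteq> A"
      using f[of K] lev_W Un_A by auto
    \<comment> \<open>The points of \<open>V\<close> precede those of \<open>K\<close>, which here
      precede those of \<open>L\<close>.\<close>
    moreover have "V \<subseteq> A"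
    proof
      fix x assume "x \<in> V"
      obtain y where "y \<in> K"
        using W.L_nonempty by auto
      then have "x < y" "y \<in> A"
        using \<open>x \<in> V\<close> W.less \<open>K \<subseteq> A\<close> by auto
      moreover have "x \<in> A \<union> L"
        using W W_eq \<open>x \<in> V\<close> triangles_below_subset by auto
      ultimately show "x \<in> A"
        using less by force
    qed
    ultimately have "W \<subseteq> A"
      by (simp add: W_eq)
    \<comment> \<open>Once no level of \<open>W\<close> is sent to \<open>L\<close>, the map
      \<open>f\<close> itself witnesses that \<open>W\<close> is below \<open>A\<close>.\<close>
    have "f M \<noteq> L" if "M \<in> levels W" for M
    proof
      assume "f M = L"
      then have "M \<subseteq> A \<inter> L"
        using f[OF that] that \<open>W \<subseteq> A\<close> Union_levels[OF triangles_belowD[OF W]] by blast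
      then show False
        using disjoint that empty_notin_levels[OF triangles_belowD[OF W]] by auto
    qed
    then have "W \<in> ?low"
      using f inj \<open>W \<subseteq> A\<close> triangles_belowD[OF W]
      by (auto simp: triangles_below_def triangle_le_def intro!: exI[of _ f])
    then show ?thesis ..
  qed
next
  fix W assume "W \<in> ?low \<union> ?top"
  then show "W \<in> ?lhs"
  proof
    assume "W \<in> ?low"
    then show ?thesis
      by (auto simp: triangles_below_def triangle_le_def levels_Un)
  next
    assume "W \<in> ?top"
    then obtain V K where W: "W = V \<union> K" and V: "V \<in> triangles_below k A"
      and K: "K \<subseteq> L" "card K = Suc k"
      by auto
    interpret W: top_level k V K
      using V K by (rule top_level_subset)
    obtain f where f: "inj_on f (levels V)"
      "\<And>M. M \<in> levels V \<Longrightarrow> f M \<in> levels A \<and> M \<subseteq> f M"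
      using V by (auto simp: triangles_below_def triangle_le_def)
    have "K \<notin> levels V"
      using W.disjoint W.L_nonempty Union_levels[OF W.A] by blast
    moreover have "L \<notin> levels A"
      using disjoint L_nonempty Union_levels[OF A] by blast
    \<comment> \<open>As \<open>K\<close> is not a level of \<open>V\<close>, the update leaves
      \<open>f\<close> unchanged there; as \<open>L\<close> is not a level of \<open>A\<close>,
      injectivity survives.\<close>
    ultimately have "inj_on (f(K := L)) (levels W)"
      using f unfolding W W.levels_Un by (auto simp: inj_on_def)
    moreover have "\<forall>M \<in> levels W. (f(K := L)) M \<in> levels (A \<union> L) \<and> M \<subseteq> (f(K := L)) M"
      using f K unfolding W W.levels_Un levels_Un by auto
    ultimately show ?thesis
      using W W.Un_in_triangles K triangles_below_subset[OF V]
      unfolding triangles_below_def triangle_le_def by blast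
  qed
qed

lemma ex_triangles_below:
  assumes "Y \<in> triangles n" "k \<le> n"
  shows "\<exists>X. X \<in> triangles_below k Y"
  using assms
proof (induction rule: triangles_induct)
  case 0
  then show ?case by simp
next
  case (Suc n A L)
  show ?case
  proof (cases "k = Suc n")
    case True
    then show ?thesis
      using Suc.hyps(1) top_level.Un_in_triangles triangles_below_self by blast
  next
    case False
    then obtain X where "X \<in> triangles_below k A"
      using Suc by auto
    then show ?thesis
      using Suc.hyps(1) by (cases k) (auto simp: top_level.triangles_below_Un)
  qed
qed

section \<open>Counting triangles with the numbers \<open>bracket n k\<close>\<close>

lemma bracket_eq_0: "n < k \<Longrightarrow> bracket n k = 0"
  by (subst bracket.simps) simp

text \<open>The default value 0 for \<open>n < k\<close> extends the recursion to the diagonal and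
  beyond.\<close>

lemma bracket_Suc_Suc:
  "bracket (Suc n) (Suc k) = bracket n (Suc k) + (Suc n choose Suc k) * bracket n k"
proof (cases k n rule: linorder_cases)
  case less
  then show ?thesis using bracket_rec[of "Suc k" "Suc n"] by simp
next
  case equal
  then show ?thesis by (simp add: bracket_diag bracket_eq_0)
next
  case greater
  then show ?thesis by (simp add: bracket_eq_0)
qed

text \<open>The recursion of \<open>triangles_below_Un\<close> mirrors that of
  \<open>bracket\<close>: a last level inside \<open>L\<close> is chosen among \<open>n + 1\<close>
  points, whence the binomial coefficient.\<close>

lemma card_triangles_below_le:
  assumes "Y \<in> triangles n"
  shows "card (triangles_below k Y) \<le> bracket n k"
  using assms
proof (induction arbitrary: k rule: triangles_induct)
  case 0
  show ?case
    using triangles_below_eq_empty[of "{}" 0 k] by (cases k) (auto simp: bracket_0)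
next
  case (Suc n A L)
  interpret top_level n A L by fact
  show ?case
  proof (cases k)
    case 0
    then show ?thesis by (simp add: bracket_0)
  next
    case (Suc j)
    let ?Ks = "{K. K \<subseteq> L \<and> card K = Suc j}"
    have "{V \<union> K | V K. V \<in> triangles_below j A \<and> K \<subseteq> L \<and> card K = Suc j}
        = (\<lambda>(V, K). V \<union> K) ` (triangles_below j A \<times> ?Ks)" (is "?top = _")
      by auto
    then have "card ?top \<le> card (triangles_below j A \<times> ?Ks)"
      using finite_triangles_below[OF A, of j] fin by (simp only:) (rule card_image_le, simp)
    also have "\<dots> = card (triangles_below j A) * (Suc n choose Suc j)"
      using fin by (simp add: card_cartesian_product n_subsets card_L)
    also have "\<dots> \<le> (Suc n choose Suc j) * bracket n j"
      using Suc.IH[of j] by simp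
    finally have top: "card ?top \<le> (Suc n choose Suc j) * bracket n j" .
    have "card (triangles_below k (A \<union> L)) \<le> card (triangles_below (Suc j) A) + card ?top"
      unfolding \<open>k = Suc j\<close> triangles_below_Un by (rule card_Un_le)
    then show ?thesis
      using top Suc.IH[of "Suc j"] unfolding \<open>k = Suc j\<close> bracket_Suc_Suc by linarith
  qed
qed

lemma bracket_pos: "k \<le> n \<Longrightarrow> 0 < bracket n k"
proof (induction n arbitrary: k)
  case 0
  then show ?case by (simp add: bracket_0)
next
  case (Suc n)
  then show ?case
    by (cases k) (auto simp: bracket_0 bracket_Suc_Suc)
qed

text \<open>The summand with the binomial coefficient is already large enough. In
  \<open>splits_step\<close> this leaves room for \<open>N\<close> levels before the last
  one.\<close>

lemma bracket_ge:
  assumes "0 < k" "k < n"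
  shows "n \<le> bracket n k"
proof -
  have "n = n choose 1"
    by simp
  also have "\<dots> \<le> n choose k"
  proof (cases "2 * k \<le> n")
    case True
    then show ?thesis
      using assms by (intro binomial_mono) auto
  next
    case False
    \<comment> \<open>In the upper half of the row, symmetry reflects \<open>k\<close> to
      \<open>n - k\<close>.\<close>
    have "n choose 1 \<le> n choose (n - k)"
      using assms False by (intro binomial_mono) auto
    then show ?thesis
      using assms binomial_symmetric[of k n] by simp
  qed
  also have "\<dots> \<le> (n choose k) * bracket (n - 1) (k - 1)"
    using bracket_pos[of "k - 1" "n - 1"] assms by (simp add: Suc_le_eq)
  finally show ?thesis
    using bracket_rec assms by simp
qed

section \<open>Iterated Ramsey numbers\<close>

lemma partn_lst_ramsey_number: "partn_lst {..<ramsey_number n k} [n, n] k"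
  unfolding ramsey_number_def by (rule LeastI_ex) (rule ramsey_full)

text \<open>Transports the partition relation from \<open>{..<ramsey_number n k}\<close> to any set
  of that size, and from the colours 0 and 1 to Booleans.\<close>

lemma ramsey_number_homogeneous:
  fixes c :: "'a set \<Rightarrow> bool"
  assumes "finite L" "card L = ramsey_number n k"
  obtains H b where "H \<subseteq> L" "card H = n" "\<And>K. K \<subseteq> H \<Longrightarrow> card K = k \<Longrightarrow> c K = b"
proof -
  let ?N = "ramsey_number n k"
  obtain g where g: "bij_betw g {..<?N} L"
    using assms by (metis atLeast0LessThan ex_bij_betw_nat_finite)
  let ?f = "\<lambda>S. of_bool (c (g ` S)) :: nat"
  have "?f \<in> nsets {..<?N} k \<rightarrow> {..<2}"
    by auto
  then obtain i H where H: "i < length [n, n]" "H \<in> nsets {..<?N} ([n, n] ! i)"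
    "?f ` nsets H k \<subseteq> {i}"
    by (rule partn_lstE[OF partn_lst_ramsey_number]) simp
  then have sub: "H \<subseteq> {..<?N}" and "finite H" "card H = n"
    by (auto simp: nsets_def less_Suc_eq)
  have inj: "inj_on g H"
    using g sub by (meson bij_betw_def inj_on_subset)
  show thesis
  proof
    show "g ` H \<subseteq> L"
      using g sub by (auto simp: bij_betw_def)
    show "card (g ` H) = n"
      using inj \<open>card H = n\<close> by (simp add: card_image)
    fix K assume K: "K \<subseteq> g ` H" "card K = k"
    then obtain S where S: "S \<subseteq> H" "inj_on g S" "K = g ` S"
      by (metis subset_image_inj)
    then have "S \<in> nsets H k"
      using K \<open>finite H\<close> by (auto simp: nsets_def card_image intro: finite_subset)
    then show "c K = (i = 1)"
      using H(3) S by (fastforce simp: of_bool_def split: if_splits)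
  qed
qed

lemma ramsey_number_ge: "n \<le> ramsey_number n k"
proof -
  obtain H :: "nat set" where "H \<subseteq> {..<ramsey_number n k}" "card H = n"
    by (rule ramsey_number_homogeneous[of "{..<ramsey_number n k}" n k "\<lambda>_. True"]) auto
  then show ?thesis
    by (metis card_lessThan card_mono finite_lessThan)
qed

text \<open>If \<open>n\<close> points sufficed, the whole set would be homogeneous; a colouring
  that singles out one \<open>k\<close>-subset prevents this.\<close>

lemma ramsey_number_gt:
  assumes "1 \<le> k" "k < n"
  shows "n < ramsey_number n k"
proof (rule ccontr)
  assume "\<not> n < ramsey_number n k"
  then have N: "ramsey_number n k = n"
    using ramsey_number_ge[of n k] by simp
  obtain H b where H: "H \<subseteq> {..<n}" "card H = n"
    and b: "\<And>K. K \<subseteq> H \<Longrightarrow> card K = k \<Longrightarrow> (K = {..<k}) = b"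
    by (rule ramsey_number_homogeneous[of "{..<n}" n k "\<lambda>K. K = {..<k}"]) (auto simp: N)
  then have "H = {..<n}"
    by (intro card_subset_eq) auto
  have "({..<k} = {..<k}) = b"
    using assms \<open>H = {..<n}\<close> by (intro b) auto
  \<comment> \<open>A second \<open>k\<close>-subset, which fits since \<open>k < n\<close> and
    differs from the first since \<open>1 \<le> k\<close>.\<close>
  moreover have "({1..k} = {..<k}) = b"
    using assms \<open>H = {..<n}\<close> by (intro b) auto
  ultimately have "{1..k} = {..<k}"
    by simp
  then have "k \<in> {..<k}"
    using assms by force
  then show False
    by simp
qed

lemma ramsey_iter_ge:
  assumes "1 \<le> k" "k < n"
  shows "n + l \<le> ramsey_iter l n k"
proof (induction l)
  case 0
  show ?case by (simp add: ramsey_iter_def)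
next
  case (Suc l)
  then have "ramsey_iter l n k < ramsey_iter (Suc l) n k"
    unfolding ramsey_iter_Suc using assms by (intro ramsey_number_gt) auto
  then show ?case
    using Suc by simp
qed

text \<open>Ramsey's theorem is applied once per element of \<open>\<V>\<close>, each time inside
  the set found before; passing to subsets preserves the homogeneity already achieved.\<close>

lemma ramsey_iter_homogeneous:
  fixes c :: "'b \<Rightarrow> 'a set \<Rightarrow> bool"
  assumes "1 \<le> k" "k < n"
    and "finite L" "card L = ramsey_iter l n k"
    and "finite \<V>" "card \<V> \<le> l"
  shows "\<exists>H d. H \<subseteq> L \<and> card H = n \<and> (\<forall>V \<in> \<V>. \<forall>K. K \<subseteq> H \<longrightarrow> card K = k \<longrightarrow> c V K = d V)"
  using assms(3-)
proof (induction l arbitrary: L \<V>)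
  case 0
  then show ?case by (auto simp: ramsey_iter_def)
next
  case (Suc l)
  show ?case
  proof (cases "\<V> = {}")
    case True
    \<comment> \<open>When no colourings are left, any \<open>n\<close> points of \<open>L\<close>
      will do, and \<open>ramsey_iter_ge\<close> ensures that there are enough.\<close>
    have "n \<le> card L"
      using ramsey_iter_ge[OF assms(1,2), of "Suc l"] Suc.prems by simp
    then show ?thesis
      using True by (metis empty_iff obtain_subset_with_card_n)
  next
    case False
    then obtain V where V: "V \<in> \<V>"
      by auto
    obtain H' b where H': "H' \<subseteq> L" "card H' = ramsey_iter l n k"
      and b: "\<And>K. K \<subseteq> H' \<Longrightarrow> card K = k \<Longrightarrow> c V K = b"
      using ramsey_number_homogeneous[of L "ramsey_iter l n k" k "c V"] Suc.prems
      by (auto simp: ramsey_iter_Suc)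
    have "card (\<V> - {V}) \<le> l"
      using Suc.prems V by simp
    moreover have "finite H'" "finite (\<V> - {V})"
      using H' Suc.prems by (auto intro: finite_subset)
    ultimately obtain H d where H: "H \<subseteq> H'" "card H = n"
      and d: "\<forall>V' \<in> \<V> - {V}. \<forall>K. K \<subseteq> H \<longrightarrow> card K = k \<longrightarrow> c V' K = d V'"
      using Suc.IH[of H' "\<V> - {V}"] H'(2) by blast
    have "c V' K = (d(V := b)) V'" if "V' \<in> \<V>" "K \<subseteq> H" "card K = k" for V' K
      using d b[of K] H that by (cases "V' = V") auto
    then show ?thesis
      using H H' by (intro exI[of _ H] exI[of _ "d(V := b)"]) blast
  qed
qed

text \<open>\<open>no_draws m n k\<close> demands \<open>n \<le> m\<close>, so a bound on the Mines
  number has to satisfy this too.\<close>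

lemma mines_bound_ge:
  assumes "1 \<le> k" "k \<le> n"
  shows "n \<le> mines_bound n k"
  using assms(2)
proof (induction n rule: dec_induct)
  case base
  show ?case by (simp add: mines_bound_diag)
next
  case (step n)
  show ?case
  proof (cases "k = 1")
    case True
    then show ?thesis by (simp add: mines_bound_1 del: One_nat_def)
  next
    case False
    then have "mines_bound (Suc n) k = ramsey_iter (bracket (diag_mines_number
        (mines_bound n k) (k - 1)) (k - 1)) (Suc n) k" (is "_ = ramsey_iter ?l _ _")
      using assms step by (intro mines_bound_Suc) auto
    then show ?thesis
      using assms step ramsey_iter_ge[of k "Suc n" ?l] by simp
  qed
qed

section \<open>Games without draws\<close>

text \<open>A triangle with fewer than \<open>k\<close> levels is vacuously monochromatic in both
  colours.\<close>

definition monochromatic_below :: "(nat set \<Rightarrow> bool) \<Rightarrow> nat \<Rightarrow> bool \<Rightarrow> nat set \<Rightarrow> bool" where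
  "monochromatic_below c k b Z \<longleftrightarrow> (\<forall>W \<in> triangles_below k Z. c W = b)"

lemma monochromatic_below_mono:
  "monochromatic_below c k b Z \<Longrightarrow> Y \<in> triangles_below n Z \<Longrightarrow> monochromatic_below c k b Y"
  unfolding monochromatic_below_def using triangles_below_trans by blast

text \<open>The condition whose least \<open>m\<close> is \<open>diag_mines_number n k\<close>,
  phrased with a colouring of all sets of numbers in place of a partition.\<close>

definition no_draws :: "nat \<Rightarrow> nat \<Rightarrow> nat \<Rightarrow> bool" where
  "no_draws m n k \<longleftrightarrow> n \<le> m \<and>
     (\<forall>B \<in> triangles m. \<forall>c. \<exists>b. \<exists>Z \<in> triangles_below n B. monochromatic_below c k b Z)"

lemma no_draws_iff:
  "no_draws m n k \<longleftrightarrow> max n n \<le> m \<and>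
     (\<forall>B X Y. completed_game m k B X Y \<longrightarrow> \<not> game_draw n n k B X Y)"
    (is "_ \<longleftrightarrow> ?rhs")
proof
  assume nd: "no_draws m n k"
  have "\<not> game_draw n n k B X Y" if "completed_game m k B X Y" for B X Y
  proof -
    have B: "B \<in> triangles m" and XY: "X \<union> Y = triangles_below k B"
      using that by (auto simp: completed_game_def)
    \<comment> \<open>Membership in \<open>X\<close> serves as the colouring; a
      \<open>k\<close>-triangle below \<open>B\<close> that is outside \<open>X\<close> lies in
      \<open>Y\<close>.\<close>
    obtain b Z where Z: "Z \<in> triangles_below n B" "monochromatic_below (\<lambda>W. W \<in> X) k b Z"
      using nd B unfolding no_draws_def by metis
    have "triangles_below k Z \<subseteq> X \<union> Y"
      using triangles_below_trans[OF _ Z(1)] XY by auto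
    then show ?thesis
      using Z unfolding monochromatic_below_def game_draw_def wins_def by (cases b) blast+
  qed
  then show ?rhs
    using nd by (simp add: no_draws_def)
next
  assume rhs: ?rhs
  have "\<exists>b. \<exists>Z \<in> triangles_below n B. monochromatic_below c k b Z" if "B \<in> triangles m" for B c
  proof -
    let ?X = "{W \<in> triangles_below k B. c W}" and ?Y = "{W \<in> triangles_below k B. \<not> c W}"
    have "completed_game m k B ?X ?Y"
      using that by (auto simp: completed_game_def)
    then have "wins n k B ?X \<or> wins n k B ?Y"
      using rhs by (auto simp: game_draw_def)
    then show ?thesis
      unfolding wins_def monochromatic_below_def by blast
  qed
  then show "no_draws m n k"
    using rhs by (simp add: no_draws_def)
qed

lemma diag_mines_number_eq: "diag_mines_number n k = (LEAST m. no_draws m n k)"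
  by (simp only: mines_number_def no_draws_iff)

text \<open>By \<open>triangles_below_Un\<close>, a triangle below \<open>P \<union> K\<close> is
  either below \<open>P\<close> or has its last level inside \<open>K\<close>; the last assumption
  on \<open>c\<close> covers the latter.\<close>

lemma (in top_level) monochromatic_below_Un:
  assumes P: "P \<in> triangles_below p A" "monochromatic_below c (Suc k) b P"
    and K: "K \<subseteq> L" "card K = Suc p"
    and c: "\<And>V K'. V \<in> triangles_below k P \<Longrightarrow> K' \<subseteq> K \<Longrightarrow> card K' = Suc k \<Longrightarrow> c (V \<union> K') = b"
  shows "P \<union> K \<in> triangles_below (Suc p) (A \<union> L)" "monochromatic_below c (Suc k) b (P \<union> K)"
proof -
  interpret P: top_level p P K
    using P K by (intro top_level_subset)
  show "P \<union> K \<in> triangles_below (Suc p) (A \<union> L)"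
    using P K by (auto simp: triangles_below_Un)
  show "monochromatic_below c (Suc k) b (P \<union> K)"
    using P(2) c by (auto simp: monochromatic_below_def P.triangles_below_Un)
qed

text \<open>The inequality is \<open>p True + p False \<ge> n + k - 1\<close> without truncated subtraction; the bound
  \<open>p b \<le> n\<close> ensures that a level of size \<open>n + 1\<close> can extend either triangle.\<close>

definition splits :: "nat \<Rightarrow> nat \<Rightarrow> nat \<Rightarrow> bool" where
  "splits m n k \<longleftrightarrow> (\<forall>B \<in> triangles m. \<forall>c. \<exists>p. n + k \<le> Suc (p True + p False) \<and>
     (\<forall>b. p b \<le> n \<and> (\<exists>P \<in> triangles_below (p b) B. monochromatic_below c k b P)))"

lemma splits_no_draws:
  assumes "splits m (2 * n - 1) k" "1 \<le> k" "n \<le> m"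
  shows "no_draws m n k"
  unfolding no_draws_def
proof (intro conjI ballI allI)
  fix B c assume "B \<in> triangles m"
  then obtain p where p: "2 * n - 1 + k \<le> Suc (p True + p False)"
    and P: "\<And>b. \<exists>P \<in> triangles_below (p b) B. monochromatic_below c k b P"
    using assms(1) unfolding splits_def by meson
  obtain b where "n \<le> p b"
  proof -
    \<comment> \<open>As \<open>1 \<le> k\<close>, the two numbers sum to at least
      \<open>2 * n - 1\<close>.\<close>
    have "n \<le> p True \<or> n \<le> p False"
      using p assms(2) by linarith
    then show thesis
      using that by blast
  qed
  obtain P where "P \<in> triangles_below (p b) B" "monochromatic_below c k b P"
    using P by blast
  moreover obtain Z where "Z \<in> triangles_below n P"
    using ex_triangles_below \<open>n \<le> p b\<close> calculation(1) triangles_belowD by blast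
  ultimately show "\<exists>b. \<exists>Z \<in> triangles_below n B. monochromatic_below c k b Z"
    using monochromatic_below_mono triangles_below_trans by blast
qed fact

text \<open>\<open>B\<close> is the only \<open>(k+1)\<close>-triangle below itself, hence
  monochromatic in its own colour; for the other colour a \<open>k\<close>-triangle works
  vacuously.\<close>

lemma splits_diag: "splits (Suc k) (Suc k) (Suc k)"
  unfolding splits_def
proof (intro ballI allI)
  fix B and c :: "nat set \<Rightarrow> bool" assume B: "B \<in> triangles (Suc k)"
  let ?p = "\<lambda>b. if b = c B then Suc k else k"
  obtain Q where Q: "Q \<in> triangles_below k B"
    using ex_triangles_below B by (meson le_SucI order_refl)
  have "triangles_below (Suc k) Q = {}"
    using triangles_below_eq_empty triangles_belowD[OF Q] by blast
  then have "\<exists>P \<in> triangles_below (?p b) B. monochromatic_below c (Suc k) b P" for b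
    using B Q by (auto simp: monochromatic_below_def triangles_below_diag intro: bexI[of _ Q])
  then show "\<exists>p. Suc k + Suc k \<le> Suc (p True + p False) \<and>
     (\<forall>b. p b \<le> Suc k \<and> (\<exists>P \<in> triangles_below (p b) B. monochromatic_below c (Suc k) b P))"
    by (intro exI[of _ ?p]) auto
qed

text \<open>Extending the triangle of one colour raises the sum by one, as the bound for
  \<open>n' + 1\<close> demands; the other triangle stays below the larger one.\<close>

lemma (in top_level) split_extend:
  assumes p: "n' + k \<le> Suc (p True + p False)"
    and P: "\<And>b. p b \<le> n' \<and> (\<exists>P \<in> triangles_below (p b) A. monochromatic_below c k b P)"
    and ext: "\<exists>P \<in> triangles_below (Suc (p b)) (A \<union> L). monochromatic_below c k b P"
  shows "\<exists>p. Suc n' + k \<le> Suc (p True + p False) \<and>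
     (\<forall>b. p b \<le> Suc n' \<and> (\<exists>P \<in> triangles_below (p b) (A \<union> L). monochromatic_below c k b P))"
proof (intro exI[of _ "p(b := Suc (p b))"] conjI allI)
  show "Suc n' + k \<le> Suc ((p(b := Suc (p b))) True + (p(b := Suc (p b))) False)"
    using p by (cases b) auto
  fix b'
  show "(p(b := Suc (p b))) b' \<le> Suc n'"
    using P by (simp add: le_SucI)
  have "triangles_below q A \<subseteq> triangles_below q (A \<union> L)" for q
    by (cases q) (auto simp: triangles_below_Un)
  then show "\<exists>P \<in> triangles_below ((p(b := Suc (p b))) b') (A \<union> L). monochromatic_below c k b' P"
    using P[of b'] ext by auto
qed

text \<open>A level of size \<open>n + 1\<close> extends one of the two triangles, unless their numbers of levels
  already sum to more than \<open>n\<close>.\<close>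

lemma splits_1: "splits n n 1"
proof (induction n)
  case 0
  have "monochromatic_below c 1 b {}" for c b
    using triangles_below_eq_empty[of "{}" 0 1] by (simp add: monochromatic_below_def)
  then show ?case
    by (auto simp: splits_def intro!: exI[of _ "\<lambda>_. 0"])
next
  case (Suc n)
  show ?case
    unfolding splits_def
  proof (intro ballI allI)
    fix B and c :: "nat set \<Rightarrow> bool" assume "B \<in> triangles (Suc n)"
    then obtain A L where "top_level n A L" and B: "B = A \<union> L"
      by (rule triangles_SucE)
    interpret top_level n A L by fact
    obtain p where p: "n + 1 \<le> Suc (p True + p False)"
      and P: "\<And>b. p b \<le> n \<and> (\<exists>P \<in> triangles_below (p b) A. monochromatic_below c 1 b P)"
      using Suc A unfolding splits_def by meson
    show "\<exists>p. Suc n + 1 \<le> Suc (p True + p False) \<and>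
       (\<forall>b. p b \<le> Suc n \<and> (\<exists>P \<in> triangles_below (p b) B. monochromatic_below c 1 b P))"
    proof (cases "Suc n + 1 \<le> Suc (p True + p False)")
      case True
      have "triangles_below q A \<subseteq> triangles_below q B" for q
        by (cases q) (auto simp: B triangles_below_Un)
      then show ?thesis
        using True P by (intro exI[of _ p]) (meson le_SucI subsetD)
    next
      case False
      let ?L = "\<lambda>b. {x \<in> L. c {x} = b}"
      have "L = ?L True \<union> ?L False" "?L True \<inter> ?L False = {}"
        by auto
      then have "card (?L True) + card (?L False) = Suc n"
        using fin card_L card_Un_disjoint[of "?L True" "?L False"] by simp
      \<comment> \<open>Here \<open>p True + p False \<le> n\<close>, so one colour class of the
        \<open>n + 1\<close> points of \<open>L\<close> can extend its triangle.\<close>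
      then have "Suc (p True) \<le> card (?L True) \<or> Suc (p False) \<le> card (?L False)"
        using False by linarith
      then obtain b where "Suc (p b) \<le> card (?L b)"
        by blast
      then obtain K where K: "K \<subseteq> ?L b" "card K = Suc (p b)"
        by (meson obtain_subset_with_card_n)
      obtain P' where P': "P' \<in> triangles_below (p b) A" "monochromatic_below c (Suc 0) b P'"
        using P[of b] by auto
      \<comment> \<open>\<open>V\<close> is empty, so \<open>V \<union> K'\<close> is a singleton
        from \<open>?L b\<close>.\<close>
      have "c (V \<union> K') = b" if "V \<in> triangles_below 0 P'" "K' \<subseteq> K" "card K' = Suc 0" for V K'
        using that K by (auto simp: card_Suc_eq)
      then have "P' \<union> K \<in> triangles_below (Suc (p b)) (A \<union> L)"
        "monochromatic_below c (Suc 0) b (P' \<union> K)"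
        using P' K monochromatic_below_Un[of P' "p b" c 0 b K] by auto
      then have "\<exists>P \<in> triangles_below (Suc (p b)) (A \<union> L). monochromatic_below c 1 b P"
        by auto
      then show ?thesis
        unfolding B using split_extend p P by blast
    qed
  qed
qed

text \<open>\<open>M\<close> stands for the previous bound and \<open>N\<close> for a number of
  levels that decides the game for \<open>k\<close>.\<close>

lemma splits_step:
  assumes k: "1 \<le> k" "Suc k \<le> n"
    and N: "no_draws N M k" and M: "n \<le> M" and IH: "splits M n (Suc k)"
  shows "splits (ramsey_iter (bracket N k) (Suc n) (Suc k)) (Suc n) (Suc k)"
  unfolding splits_def
proof (intro ballI allI)
  let ?m = "ramsey_iter (bracket N k) (Suc n) (Suc k)"
  fix B and c :: "nat set \<Rightarrow> bool" assume B: "B \<in> triangles ?m"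
  have "M \<le> N"
    using N by (simp add: no_draws_def)
  then have "N \<le> bracket N k"
    using k M by (intro bracket_ge) auto
  \<comment> \<open>One level is reserved for \<open>L\<close>, so \<open>N\<close> further levels
    must remain in \<open>A\<close>.\<close>
  then have "Suc N \<le> ?m"
    using ramsey_iter_ge[of "Suc k" "Suc n" "bracket N k"] k by simp
  then obtain m where m: "?m = Suc m" "N \<le> m"
    by (metis Suc_le_D Suc_le_mono)
  obtain A L where "top_level m A L" and B_eq: "B = A \<union> L"
    using B unfolding m by (rule triangles_SucE)
  interpret top_level m A L by fact
  obtain B' where B': "B' \<in> triangles_below N A"
    using ex_triangles_below A \<open>N \<le> m\<close> by blast
  have B'_tri: "B' \<in> triangles N"
    using B' by (rule triangles_belowD)
  \<comment> \<open>\<open>L\<close> has exactly as many points as the iterated Ramsey number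
    requires, because the \<open>i\<close>-th level of a triangle has \<open>i\<close>
    points.\<close>
  obtain H d where H: "H \<subseteq> L" "card H = Suc n"
    and d: "\<And>V K. V \<in> triangles_below k B' \<Longrightarrow> K \<subseteq> H \<Longrightarrow> card K = Suc k \<Longrightarrow>
      c (V \<union> K) = d V"
    using ramsey_iter_homogeneous[of "Suc k" "Suc n" L "bracket N k" "triangles_below k B'"
        "\<lambda>V K. c (V \<union> K)"]
      k fin card_L m finite_triangles_below[OF B'_tri] card_triangles_below_le[OF B'_tri]
    by auto
  obtain b C where C: "C \<in> triangles_below M B'" and mono: "monochromatic_below d k b C"
    using N B'_tri unfolding no_draws_def by meson
  \<comment> \<open>Using \<open>IH\<close> inside \<open>C\<close> ensures that every
    \<open>k\<close>-triangle below either of the two resulting triangles has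
    \<open>d\<close>-colour \<open>b\<close>.\<close>
  obtain p where p: "n + Suc k \<le> Suc (p True + p False)"
    and P: "\<And>b. p b \<le> n \<and> (\<exists>P \<in> triangles_below (p b) C. monochromatic_below c (Suc k) b P)"
    using IH triangles_belowD[OF C] unfolding splits_def by meson
  have C_A: "C \<in> triangles_below M A"
    using C B' by (rule triangles_below_trans)
  have P_A: "p b \<le> n \<and> (\<exists>P \<in> triangles_below (p b) A. monochromatic_below c (Suc k) b P)" for b
    using P[of b] triangles_below_trans[OF _ C_A] by blast
  obtain P' where P': "P' \<in> triangles_below (p b) C" "monochromatic_below c (Suc k) b P'"
    using P by blast
  \<comment> \<open>\<open>p b \<le> n\<close> gives room in \<open>H\<close> for the level of size
    \<open>p b + 1\<close> that extends the triangle of colour \<open>b\<close>.\<close>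
  obtain K where K: "K \<subseteq> H" "card K = Suc (p b)"
    using P[of b] H by (metis Suc_le_mono obtain_subset_with_card_n)
  have "c (V \<union> K') = b" if "V \<in> triangles_below k P'" "K' \<subseteq> K" "card K' = Suc k" for V K'
  proof -
    have "V \<in> triangles_below k C"
      using that P' triangles_below_trans by blast
    then show ?thesis
      using d[of V K'] that K mono triangles_below_trans[OF _ C]
      unfolding monochromatic_below_def by blast
  qed
  then have "\<exists>P \<in> triangles_below (Suc (p b)) (A \<union> L). monochromatic_below c (Suc k) b P"
    using monochromatic_below_Un[of P' "p b" c k b K] P' K H triangles_below_trans[OF _ C_A]
    by blast
  then show "\<exists>p. Suc n + Suc k \<le> Suc (p True + p False) \<and>
     (\<forall>b. p b \<le> Suc n \<and> (\<exists>P \<in> triangles_below (p b) B. monochromatic_below c (Suc k) b P))"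
    unfolding B_eq using split_extend p P_A by blast
qed

text \<open>The outer induction on \<open>k\<close> provides the Mines numbers that the inner
  induction on \<open>n\<close> uses in the recursion for \<open>k + 1\<close>.\<close>

lemma splits_mines_bound:
  assumes "1 \<le> k" "k \<le> n"
  shows "splits (mines_bound n k) n k"
  using assms
proof (induction k arbitrary: n rule: nat_induct_at_least)
  case base
  then show ?case
    using splits_1 by (simp add: mines_bound_1 del: One_nat_def)
next
  case (Suc k)
  \<comment> \<open>Ensures that the minimum defining \<open>diag_mines_number p k\<close> is
    attained, so that this number does exclude draws.\<close>
  have ex: "\<exists>m. no_draws m p k" if "k \<le> p" for p
  proof -
    have "splits (mines_bound (2 * p - 1) k) (2 * p - 1) k"
      using Suc that by simp
    moreover have "p \<le> mines_bound (2 * p - 1) k"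
      using mines_bound_ge[of k "2 * p - 1"] Suc.hyps that by linarith
    ultimately show ?thesis
      using Suc.hyps splits_no_draws by blast
  qed
  show ?case
    using Suc.prems
  proof (induction n rule: dec_induct)
    case base
    show ?case
      using splits_diag by (simp add: mines_bound_diag)
  next
    case (step n)
    let ?M = "mines_bound n (Suc k)"
    have "n \<le> ?M"
      using step.hyps by (intro mines_bound_ge) simp_all
    then have "\<exists>m. no_draws m ?M k"
      using step.hyps by (intro ex) simp
    then have "no_draws (diag_mines_number ?M k) ?M k"
      unfolding diag_mines_number_eq by (rule LeastI_ex)
    then have "splits (ramsey_iter (bracket (diag_mines_number ?M k) k) (Suc n) (Suc k))
        (Suc n) (Suc k)"
      by (rule splits_step[OF Suc.hyps step.hyps(1) _ \<open>n \<le> ?M\<close> step.IH])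
    moreover have "mines_bound (Suc n) (Suc k)
        = ramsey_iter (bracket (diag_mines_number ?M (Suc k - 1)) (Suc k - 1)) (Suc n) (Suc k)"
      using Suc.hyps step.hyps by (intro mines_bound_Suc) simp_all
    ultimately show ?case
      by (simp only: diff_Suc_1)
  qed
qed

theorem theorem7:
  fixes n k :: nat
  assumes "1 \<le> k" and "k \<le> n"
  shows "diag_mines_number n k \<le> mines_bound (2 * n - 1) k"
proof -
  have "n \<le> mines_bound (2 * n - 1) k"
    using mines_bound_ge[of k "2 * n - 1"] assms by linarith
  then have "no_draws (mines_bound (2 * n - 1) k) n k"
    using assms by (intro splits_no_draws splits_mines_bound) auto
  then show ?thesis
    unfolding diag_mines_number_eq by (rule Least_le)
qed

end
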